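(* Let $S\subset\mathbb{E}^3$ be a closed convex surface with rational support function $r=P(\xi,\bar\xi)/Q(\xi,\bar\xi)$, where $P$ and $Q$ are real-valued polynomials without common factors, with $\deg(P)=n\leq \deg(Q)=m$, and write $$P(\xi,\bar\xi)=\sum_{k,l=0}^m A_{kl}\,\xi^k\bar\xi^l,\qquad Q(\xi,\bar\xi)=\sum_{k,l=0}^m B_{kl}\,\xi^k\bar\xi^l .$$ Then $S$ is of constant width $w$ if and only if there is some (nonzero) $K\in\mathbb{R}$ such that both of the following hold: (1) $$Q\left(-\frac1{\bar\xi},-\frac1\xi\right)=\frac{1}{K\,\xi^m\bar\xi^m}\,Q(\xi,\bar\xi);$$ (2) for all $0\le k,l\le m$, $$A_{kl}+(-1)^{k+l}\,K\,A_{m-l\;m-k}=w\,B_{kl}.$$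
   Context: The unit sphere $S^2$ carries the complex coordinate $\xi=\tan(\theta/2)e^{i\phi}$ (stereographic projection from the south pole, $(\theta,\phi)$ standard spherical polar angles). The support function $r:S^2\to\mathbb{R}$ of a closed convex surface $S$ gives the (signed) distance from the origin to the tangent plane of $S$ with outward normal direction $\xi$. The antipodal map is $\tau(\xi)=-1/\bar\xi$, and $S$ has constant width $w$ if $r+r\circ\tau\equiv w$ on $S^2$. A closed convex surface has rational support if its support function is of the form $r=P(\xi,\bar\xi)/Q(\xi,\bar\xi)$ with $P,Q$ real-valued polynomials in $\xi,\bar\xi$ (with complex coefficients). Since $P$ is real-valued, its degree in $\xi$ equals its degree in $\bar\xi$, and this common number is called $\deg(P)$; similarly for $Q$. In the expansion of $P$, coefficients $A_{kl}$ with $k>n$ or $l>n$ are zero. Having no common factors means that $P(z_1,z_2)$ and $Q(z_1,z_2)$ are coprime in $\mathbb{C}[z_1,z_2]$. *)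

theory Defs
  imports "HOL-Analysis.Analysis" "HOL-Computational_Algebra.Polynomial"
begin

text \<open>The point of the unit sphere with coordinate \<open>\<xi> = tan (\<theta>/2) e^(i\<phi>)\<close>; every point except the
  south pole, which is \<open>\<xi> = \<infinity>\<close>, is of this form.\<close>

definition sph :: "complex \<Rightarrow> real ^ 3" where
  "sph \<xi> = (1 / (1 + (cmod \<xi>)\<^sup>2)) *\<^sub>R vector [2 * Re \<xi>, 2 * Im \<xi>, 1 - (cmod \<xi>)\<^sup>2]"

lemma sph_polar:
  assumes "0 \<le> \<theta>" "\<theta> < pi"
  shows "sph (complex_of_real (tan (\<theta> / 2)) * cis \<phi>) =
           vector [sin \<theta> * cos \<phi>, sin \<theta> * sin \<phi>, cos \<theta>]"
proof -
  define c s where "c = cos (\<theta> / 2)" and "s = sin (\<theta> / 2)"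
  have c: "c > 0" unfolding c_def using assms by (intro cos_gt_zero_pi) auto
  have cs: "c\<^sup>2 + s\<^sup>2 = 1" by (simp add: c_def s_def)
  have st: "sin \<theta> = 2 * s * c" using sin_double[of "\<theta> / 2"] by (simp add: c_def s_def)
  have ct: "cos \<theta> = c\<^sup>2 - s\<^sup>2" using cos_double[of "\<theta> / 2"] by (simp add: c_def s_def)
  have t: "tan (\<theta> / 2) = s / c" by (simp add: tan_def c_def s_def)
  have n: "(cmod (complex_of_real (tan (\<theta> / 2)) * cis \<phi>))\<^sup>2 = s\<^sup>2 / c\<^sup>2"
    by (simp add: norm_mult norm_divide t power_divide)
  have d: "1 + s\<^sup>2 / c\<^sup>2 = 1 / c\<^sup>2" using c cs by (simp add: field_simps)
  have q: "1 / (1 + s\<^sup>2 / c\<^sup>2) = c\<^sup>2" unfolding d by simp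
  show ?thesis
    unfolding sph_def n q st ct
    using c by (simp add: vec_eq_iff forall_3 vector_3 t power2_eq_square right_diff_distrib)
qed

lemma norm_sph: "norm (sph \<xi>) = 1"
proof -
  have p: "0 < 1 + (cmod \<xi>)\<^sup>2" by (simp add: add_pos_nonneg)
  have "norm (vector [2 * Re \<xi>, 2 * Im \<xi>, 1 - (cmod \<xi>)\<^sup>2] :: real ^ 3) = 1 + (cmod \<xi>)\<^sup>2"
    unfolding norm_vec_def L2_set_def sum_3 vector_3 real_norm_def power2_abs cmod_power2
    by (rule real_sqrt_unique) (simp_all add: power2_eq_square algebra_simps)
  then show ?thesis using p by (simp add: sph_def)
qed

lemma sph_antipodal:
  assumes "\<xi> \<noteq> 0"
  shows "sph (- 1 / cnj \<xi>) = - sph \<xi>"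
proof -
  define a b N where "a = Re \<xi>" and "b = Im \<xi>" and "N = (cmod \<xi>)\<^sup>2"
  have N: "N > 0" using assms by (simp add: N_def)
  have "- 1 / cnj \<xi> = - \<xi> / complex_of_real N"
    using assms unfolding N_def complex_norm_square by (simp add: field_simps)
  then have e: "Re (- 1 / cnj \<xi>) = - a / N" "Im (- 1 / cnj \<xi>) = - b / N"
    by (simp_all add: a_def b_def)
  have m: "(cmod (- 1 / cnj \<xi>))\<^sup>2 = 1 / N"
    by (simp add: N_def norm_divide power_divide)
  have q: "1 / (1 + 1 / N) = N / (1 + N)" using N by (simp add: field_simps)
  show ?thesis
    unfolding sph_def e m q N_def[symmetric] a_def[symmetric] b_def[symmetric]
    using N by (simp add: vec_eq_iff forall_3 vector_3 divide_simps algebra_simps)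
qed

definition closed_convex_surface :: "(real ^ 3) set \<Rightarrow> bool" where
  "closed_convex_surface S \<longleftrightarrow>
     (\<exists>C. compact C \<and> convex C \<and> interior C \<noteq> {} \<and> S = frontier C)"

text \<open>For a unit vector \<open>u\<close> the plane \<open>{x. u \<bullet> x = h}\<close> lies at signed distance \<open>h\<close> from the origin.
  The value below is the \<open>h\<close> of the tangent (supporting) plane of \<open>S\<close> with outward normal \<open>u\<close>.\<close>

definition support_function :: "(real ^ 3) set \<Rightarrow> real ^ 3 \<Rightarrow> real" where
  "support_function S u = (SUP x\<in>S. u \<bullet> x)"

lemma support_function_tangent_plane:
  assumes "closed_convex_surface S"
  shows "(\<exists>x\<in>S. u \<bullet> x = h) \<and> S \<subseteq> {x. u \<bullet> x \<le> h} \<longleftrightarrow> h = support_function S u"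
proof -
  obtain C where C: "compact C" "interior C \<noteq> {}" "S = frontier C"
    using assms by (auto simp: closed_convex_surface_def)
  have S: "compact S" using C by (simp add: compact_frontier)
  have "C \<noteq> UNIV" using C(1) compact_imp_bounded not_bounded_UNIV by blast
  moreover have "C \<noteq> {}" using C(2) by auto
  ultimately have ne: "S \<noteq> {}" using C(3) frontier_not_empty by blast
  have "continuous_on S (\<lambda>x. u \<bullet> x)" by (intro continuous_intros)
  then obtain x where x: "x \<in> S" "\<forall>y\<in>S. u \<bullet> y \<le> u \<bullet> x"
    using continuous_attains_sup[OF S ne] by blast
  have "support_function S u = u \<bullet> x"
    unfolding support_function_def using x by (intro cSup_eq_maximum) auto
  then show ?thesis using x by force
qed

definition constant_width :: "(real ^ 3) set \<Rightarrow> real \<Rightarrow> bool" where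
  "constant_width S w \<longleftrightarrow>
     (\<forall>u\<in>sphere 0 1. support_function S u + support_function S (- u) = w)"

text \<open>The ring of polynomials in \<open>z\<^sub>1, z\<^sub>2\<close> is \<open>complex poly poly\<close>, with \<open>z\<^sub>1\<close> the outer and
  \<open>z\<^sub>2\<close> the inner variable; thus \<open>degree\<close> is the degree in \<open>z\<^sub>1\<close>.\<close>

definition poly2 :: "complex poly poly \<Rightarrow> complex \<Rightarrow> complex \<Rightarrow> complex" where
  "poly2 P z1 z2 = poly (poly P [:z1:]) z2"

definition coeff2 :: "complex poly poly \<Rightarrow> nat \<Rightarrow> nat \<Rightarrow> complex" where
  "coeff2 P k l = coeff (coeff P k) l"

definition real_valued :: "complex poly poly \<Rightarrow> bool" where
  "real_valued P \<longleftrightarrow> (\<forall>\<xi>. poly2 P \<xi> (cnj \<xi>) \<in> \<real>)"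

text \<open>The equality \<open>r = P / Q\<close> is required at the points where the quotient is defined.\<close>

definition rational_support ::
    "(real ^ 3) set \<Rightarrow> complex poly poly \<Rightarrow> complex poly poly \<Rightarrow> bool" where
  "rational_support S P Q \<longleftrightarrow>
     real_valued P \<and> real_valued Q \<and> Q \<noteq> 0 \<and>
     (\<forall>\<xi>. poly2 Q \<xi> (cnj \<xi>) \<noteq> 0 \<longrightarrow>
        complex_of_real (support_function S (sph \<xi>)) = poly2 P \<xi> (cnj \<xi>) / poly2 Q \<xi> (cnj \<xi>))"

lemma sum_cnj_eq_0_imp_coeff_eq_0:
  assumes "\<And>\<xi>. (\<Sum>k\<le>m. \<Sum>l\<le>m. a k l * \<xi> ^ k * cnj \<xi> ^ l) = 0" "k \<le> m" "l \<le> m"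
  shows "a k l = 0"
proof -
  define f where "f z1 z2 = (\<Sum>k\<le>m. \<Sum>l\<le>m. a k l * z1 ^ k * z2 ^ l)" for z1 z2
  have poly_0: "p = 0" if "\<And>t::real. poly p (complex_of_real t) = 0" for p
  proof (rule ccontr)
    assume "p \<noteq> 0"
    then have "finite {z. poly p z = 0}" by (rule poly_roots_finite)
    moreover have "range complex_of_real \<subseteq> {z. poly p z = 0}" using that by auto
    ultimately have "finite (range complex_of_real)" by (rule rev_finite_subset)
    then have "finite (UNIV :: real set)" by (rule finite_imageD) (simp add: inj_of_real)
    then show False using infinite_UNIV_char_0 by blast
  qed
  define p where "p x = (\<Sum>k\<le>m. \<Sum>l\<le>m. smult (a k l) ([:x, \<i>:] ^ k * [:x, - \<i>:] ^ l))" for x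
  define q where "q y = (\<Sum>k\<le>m. \<Sum>l\<le>m. smult (a k l) ([:\<i> * y, 1:] ^ k * [:- \<i> * y, 1:] ^ l))" for y
  have p: "poly (p x) y = f (x + \<i> * y) (x - \<i> * y)" for x y
    by (simp add: p_def f_def poly_sum mult_ac)
  have q: "poly (q y) x = f (x + \<i> * y) (x - \<i> * y)" for x y
    by (simp add: q_def f_def poly_sum mult_ac add_ac)
  have p0: "p (complex_of_real x) = 0" for x
  proof (rule poly_0)
    show "poly (p (complex_of_real x)) (complex_of_real t) = 0" for t
      using assms(1)[of "complex_of_real x + \<i> * complex_of_real t"] by (simp add: p f_def)
  qed
  have q0: "q y = 0" for y
  proof (rule poly_0)
    show "poly (q y) (complex_of_real t) = 0" for t
      using p[of "complex_of_real t" y] unfolding p0 q by simp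
  qed
  have f0: "f (x + \<i> * y) (x - \<i> * y) = 0" for x y
    using q[of y x] unfolding q0 by simp
  have f: "f z1 z2 = 0" for z1 z2
  proof -
    have "(z1 + z2) / 2 + \<i> * ((z1 - z2) / (2 * \<i>)) = z1"
      "(z1 + z2) / 2 - \<i> * ((z1 - z2) / (2 * \<i>)) = z2"
      by (simp_all add: field_simps)
    then show ?thesis using f0[of "(z1 + z2) / 2" "(z1 - z2) / (2 * \<i>)"] by simp
  qed
  have "(\<Sum>l\<le>m. a k l * z2 ^ l) = 0" for z2
  proof -
    have "\<forall>z. (\<Sum>k\<le>m. (\<Sum>l\<le>m. a k l * z2 ^ l) * z ^ k) = 0"
      using f[of _ z2] unfolding f_def sum_distrib_right by (simp add: mult_ac)
    then show ?thesis using \<open>k \<le> m\<close> unfolding polyfun_eq_0 by blast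
  qed
  then have "\<forall>z. (\<Sum>l\<le>m. a k l * z ^ l) = 0" by blast
  then show ?thesis using \<open>l \<le> m\<close> unfolding polyfun_eq_0 by blast
qed

lemma poly2_altdef_gen:
  assumes "\<And>k. k > m \<Longrightarrow> coeff P k = 0" "\<And>k l. l > m \<Longrightarrow> coeff2 P k l = 0"
  shows "poly2 P z1 z2 = (\<Sum>k\<le>m. \<Sum>l\<le>m. coeff2 P k l * z1 ^ k * z2 ^ l)"
proof -
  have d: "degree P \<le> m" using assms(1) by (intro degree_le) auto
  have d': "degree (coeff P k) \<le> m" for k
    using assms(2)[of _ k] by (intro degree_le) (auto simp: coeff2_def)
  have c: "poly (coeff P k) z2 = (\<Sum>l\<le>m. coeff2 P k l * z2 ^ l)" for k
    unfolding poly_altdef coeff2_def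
    by (rule sum.mono_neutral_left) (use d' in \<open>auto simp: coeff_eq_0\<close>)
  have "poly P [:z1:] = (\<Sum>k\<le>m. coeff P k * [:z1:] ^ k)"
    unfolding poly_altdef
    by (rule sum.mono_neutral_left) (use d in \<open>auto simp: coeff_eq_0\<close>)
  then have "poly2 P z1 z2 = (\<Sum>k\<le>m. poly (coeff P k) z2 * z1 ^ k)"
    by (simp add: poly2_def poly_sum)
  also have "\<dots> = (\<Sum>k\<le>m. \<Sum>l\<le>m. coeff2 P k l * z1 ^ k * z2 ^ l)"
    unfolding c sum_distrib_right by (intro sum.cong refl) (simp add: mult_ac)
  finally show ?thesis .
qed

lemma real_valued_coeff2:
  assumes "real_valued P"
  shows "coeff2 P l k = cnj (coeff2 P k l)"
proof -
  define N where "N = Max (insert k (insert l (insert (degree P) ((\<lambda>i. degree (coeff P i)) ` {..degree P}))))"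
  have N: "k \<le> N" "l \<le> N" "degree P \<le> N" by (simp_all add: N_def)
  have "degree (coeff P i) \<le> N" for i
  proof (cases "i \<le> degree P")
    case True then show ?thesis unfolding N_def by (intro Max_ge) auto
  qed (simp add: coeff_eq_0)
  then have c: "i > N \<Longrightarrow> coeff P i = 0" "j > N \<Longrightarrow> coeff2 P i j = 0" for i j
    using N(3) by (auto simp: coeff2_def intro!: coeff_eq_0 intro: le_less_trans)
  have e: "poly2 P z1 z2 = (\<Sum>i\<le>N. \<Sum>j\<le>N. coeff2 P i j * z1 ^ i * z2 ^ j)" for z1 z2
    using c by (intro poly2_altdef_gen)
  have "(\<Sum>i\<le>N. \<Sum>j\<le>N. (coeff2 P i j - cnj (coeff2 P j i)) * \<xi> ^ i * cnj \<xi> ^ j) = 0" for \<xi>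
  proof -
    have "cnj (poly2 P \<xi> (cnj \<xi>)) = poly2 P \<xi> (cnj \<xi>)"
      using assms unfolding real_valued_def Reals_cnj_iff by blast
    moreover have "cnj (poly2 P \<xi> (cnj \<xi>)) =
        (\<Sum>i\<le>N. \<Sum>j\<le>N. cnj (coeff2 P j i) * \<xi> ^ i * cnj \<xi> ^ j)"
      unfolding e by (subst sum.swap) (simp add: mult_ac)
    ultimately show ?thesis unfolding e by (simp add: left_diff_distrib sum_subtractf)
  qed
  from sum_cnj_eq_0_imp_coeff_eq_0[OF this N(2,1)] show ?thesis by simp
qed

lemma real_valued_degree:
  assumes "real_valued P"
  shows "(MAX k\<in>{..degree P}. degree (coeff P k)) = degree P"
proof (rule Max_eqI)
  have sym: "coeff2 P k l = 0 \<longleftrightarrow> coeff2 P l k = 0" for k l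
    using real_valued_coeff2[OF assms, of l k] by simp
  have z: "coeff2 P k l = 0" if "l > degree P" for k l
    using that sym[of k l] by (simp add: coeff2_def coeff_eq_0)
  have le: "degree (coeff P k) \<le> degree P" for k
    using z[of _ k] by (intro degree_le) (auto simp: coeff2_def)
  then show "y \<le> degree P" if "y \<in> (\<lambda>k. degree (coeff P k)) ` {..degree P}" for y
    using that by auto
  show "degree P \<in> (\<lambda>k. degree (coeff P k)) ` {..degree P}"
  proof (cases "P = 0")
    case False
    then obtain k where "coeff2 P (degree P) k \<noteq> 0"
      by (metis coeff2_def leading_coeff_0_iff poly_eqI coeff_0)
    then have k: "coeff2 P k (degree P) \<noteq> 0" using sym by blast
    then have "k \<le> degree P" by (metis coeff2_def coeff_0 coeff_eq_0 not_le)
    moreover have "degree (coeff P k) = degree P"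
      using k le[of k] le_degree[of "coeff P k" "degree P"] by (simp add: coeff2_def)
    ultimately show ?thesis by (metis atMost_iff imageI)
  qed simp
qed simp

lemma poly2_altdef:
  assumes "real_valued P" "degree P \<le> m"
  shows "poly2 P z1 z2 = (\<Sum>k\<le>m. \<Sum>l\<le>m. coeff2 P k l * z1 ^ k * z2 ^ l)"
proof (rule poly2_altdef_gen)
  show z: "coeff P k = 0" if "k > m" for k using that assms(2) by (simp add: coeff_eq_0)
  show "coeff2 P k l = 0" if "l > m" for k l
    using real_valued_coeff2[OF assms(1), of k l] z[OF that] by (simp add: coeff2_def)
qed

end

theory Submission
  imports
    Defs
    "HOL-Computational_Algebra.Field_as_Ring"
    "HOL-Computational_Algebra.Polynomial_Factorial"
begin

text \<open>Write \<open>F\<^sup>*\<close> for the polynomial \<open>(z\<^sub>1 z\<^sub>2)\<^sup>m F(-1/z\<^sub>2, -1/z\<^sub>1)\<close>, the pull-back of \<open>F\<close> under the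
  antipodal map with denominators cleared. Constant width says \<open>P/Q + P\<^sup>*/Q\<^sup>* = w\<close> wherever the
  quotients make sense. A polynomial that vanishes at all points \<open>(\<xi>, cnj \<xi>)\<close> is zero, so this is
  the identity \<open>P Q\<^sup>* + P\<^sup>* Q = w Q Q\<^sup>*\<close> in \<open>\<complex>[z\<^sub>1, z\<^sub>2]\<close>. It shows that \<open>Q\<close> divides \<open>P Q\<^sup>*\<close>, hence
  \<open>Q\<^sup>*\<close>, since \<open>P\<close> and \<open>Q\<close> are coprime. But the degree of \<open>Q\<^sup>*\<close> in either variable is at most \<open>m\<close>,
  which is the degree of \<open>Q\<close> in both variables, so \<open>Q\<^sup>* = a Q\<close> with a constant \<open>a\<close>
  (\<open>antipodal_dvd_imp_real_multiple\<close>). It is nonzero, and real because \<open>Q\<close> and \<open>Q\<^sup>*\<close> are both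
  real-valued. With \<open>K = 1/a\<close> this is the symmetry condition on \<open>Q\<close>, and cancelling \<open>Q\<close> from
  the identity leaves \<open>P + K P\<^sup>* = w Q\<close>, which is the coefficient condition.

  Conversely, the two conditions give \<open>P/Q + P\<^sup>*/Q\<^sup>* = w\<close> at every \<open>\<xi> \<noteq> 0\<close> with \<open>Q \<noteq> 0\<close>. The
  remaining points of the sphere are reached by continuity: a support function is Lipschitz
  (\<open>support_function_lipschitz\<close>), and a continuous function that is constant off the zero set of a
  nonzero polynomial is constant (\<open>continuous_eq_const_off_zero_set\<close>).\<close>

section \<open>Polynomials evaluated at conjugate pairs\<close>

lemma poly2_simps [simp]:
  "poly2 (F + G) x y = poly2 F x y + poly2 G x y"
  "poly2 (F - G) x y = poly2 F x y - poly2 G x y"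
  "poly2 (F * G) x y = poly2 F x y * poly2 G x y"
  "poly2 0 x y = 0"
  "poly2 (pCons c F) x y = poly c y + x * poly2 F x y"
  "poly2 (smult c F) x y = poly c y * poly2 F x y"
  by (simp_all add: poly2_def)

lemma poly2_conj_eq_0_imp_eq_0:
  assumes "\<And>\<xi>. poly2 F \<xi> (cnj \<xi>) = 0"
  shows "F = 0"
proof -
  \<comment> \<open>Real values make the coefficients symmetric up to conjugation, so that the degree in \<open>z\<^sub>1\<close> also
    bounds the degree in \<open>z\<^sub>2\<close>.\<close>
  have r: "real_valued F" by (simp add: real_valued_def assms)
  let ?d = "degree F"
  have "coeff2 F k l = 0" if "k \<le> ?d" "l \<le> ?d" for k l
    by (rule sum_cnj_eq_0_imp_coeff_eq_0[OF _ that])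
      (use assms in \<open>simp add: poly2_altdef[OF r order_refl]\<close>)
  moreover have "coeff2 F k l = 0" if "k > ?d" for k l
    using that by (simp add: coeff2_def coeff_eq_0)
  ultimately have "coeff2 F k l = 0" for k l
    using real_valued_coeff2[OF r, of k l] by (metis complex_cnj_zero not_le)
  then show ?thesis by (auto simp: coeff2_def poly_eq_iff)
qed

text \<open>Join a given point by a real line to a point where \<open>F\<close> does not vanish. On that line \<open>F\<close> is a
  nonzero polynomial in one real parameter, so its zeros do not accumulate at the given point.\<close>

lemma continuous_eq_const_off_zero_set:
  fixes g :: "complex \<Rightarrow> real"
  assumes "F \<noteq> 0" and g: "continuous_on UNIV g"
    and eq: "\<And>\<xi>. poly2 F \<xi> (cnj \<xi>) \<noteq> 0 \<Longrightarrow> g \<xi> = w"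
  shows "g \<xi> = w"
proof -
  obtain \<eta> where \<eta>: "poly2 F \<eta> (cnj \<eta>) \<noteq> 0"
    using poly2_conj_eq_0_imp_eq_0 \<open>F \<noteq> 0\<close> by blast
  define d where "d = \<eta> - \<xi>"
  define L where "L t = \<xi> + complex_of_real t * d" for t
  \<comment> \<open>The parameter is real, hence its own conjugate, which makes the restriction a polynomial in it.\<close>
  define p where "p = (\<Sum>k\<le>degree F. pcompose (coeff F k) [:cnj \<xi>, cnj d:] * [:\<xi>, d:] ^ k)"
  have p: "poly p (complex_of_real t) = poly2 F (L t) (cnj (L t))" for t
    by (simp add: p_def poly2_def poly_altdef[of F] poly_sum poly_pcompose L_def mult_ac)
  have "poly p (complex_of_real 1) \<noteq> 0" unfolding p using \<eta> by (simp add: L_def d_def)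
  then have "p \<noteq> 0" by auto
  then have "finite {z. poly p z = 0}" by (rule poly_roots_finite)
  then have "finite (complex_of_real -` {z. poly p z = 0})"
    by (rule finite_vimageI) (simp add: inj_of_real)
  then have "\<forall>\<^sub>F t in at 0. t \<notin> complex_of_real -` {z. poly p z = 0}"
    using islimpt_finite unfolding islimpt_iff_eventually by blast
  then have "\<forall>\<^sub>F t in at 0. g (L t) = w"
    by eventually_elim (use eq p in auto)
  then have 1: "((\<lambda>t. g (L t)) \<longlongrightarrow> w) (at 0)" by (rule tendsto_eventually)
  have "continuous_on UNIV (\<lambda>t. g (L t))"
    by (rule continuous_on_compose2[OF g]) (auto simp: L_def intro!: continuous_intros)
  then have "isCont (\<lambda>t. g (L t)) 0" by (simp add: continuous_on_eq_continuous_at)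
  then have 2: "((\<lambda>t. g (L t)) \<longlongrightarrow> g (L 0)) (at 0)" by (simp add: isCont_def)
  show ?thesis using tendsto_unique[OF _ 2 1] by (simp add: L_def)
qed

section \<open>The antipodal transform of a polynomial\<close>

text \<open>This is \<open>(z\<^sub>1 z\<^sub>2)\<^sup>m F(-1/z\<^sub>2, -1/z\<^sub>1)\<close> if \<open>F\<close> has degree at most \<open>m\<close> in each variable. For
  \<open>z\<^sub>2 = cnj z\<^sub>1\<close> the arguments of \<open>F\<close> are the antipode of \<open>z\<^sub>1\<close> and its conjugate. Substituting for
  both variables exchanges the two exponents, hence the transposed indices.\<close>

definition antipodal :: "nat \<Rightarrow> complex poly poly \<Rightarrow> complex poly poly" where
  "antipodal m F =
     (\<Sum>k\<le>m. monom (\<Sum>l\<le>m. monom ((- 1) ^ (k + l) * coeff2 F (m - l) (m - k)) l) k)"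

lemma coeff2_antipodal:
  "coeff2 (antipodal m F) k l =
     (if k \<le> m \<and> l \<le> m then (- 1) ^ (k + l) * coeff2 F (m - l) (m - k) else 0)"
  by (simp add: coeff2_def antipodal_def coeff_sum if_distrib sum.If_cases cong: if_cong)

lemma degree_antipodal: "degree (antipodal m F) \<le> m"
  by (rule degree_le) (auto simp: poly_eq_iff coeff2_antipodal simp flip: coeff2_def)

lemma coeff2_eq_0_of_degree:
  assumes "real_valued F" "degree F \<le> m" "k > m \<or> l > m"
  shows "coeff2 F k l = 0"
proof -
  have *: "coeff2 F i j = 0" if "i > m" for i j
    using that assms(2) by (simp add: coeff2_def coeff_eq_0)
  then show ?thesis using assms(3) real_valued_coeff2[OF assms(1), of k l] by auto
qed

lemma antipodal_eq_0_iff: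
  assumes "real_valued F" "degree F \<le> m"
  shows "antipodal m F = 0 \<longleftrightarrow> F = 0"
proof
  assume 0: "antipodal m F = 0"
  have "coeff2 F k l = 0" for k l
  proof (cases "k \<le> m \<and> l \<le> m")
    case True
    then show ?thesis
      using coeff2_antipodal[of m F "m - l" "m - k"] unfolding 0 by (simp add: coeff2_def)
  qed (use coeff2_eq_0_of_degree[OF assms] in auto)
  then show "F = 0" by (auto simp: poly_eq_iff coeff2_def)
qed (simp add: antipodal_def coeff2_def)

lemma poly2_antipodal:
  assumes "real_valued F" "degree F \<le> m" "z1 \<noteq> 0" "z2 \<noteq> 0"
  shows "poly2 (antipodal m F) z1 z2 = z1 ^ m * z2 ^ m * poly2 F (- 1 / z2) (- 1 / z1)"
proof -
  have t: "(- 1) ^ (k + l) * c * z1 ^ k * z2 ^ l =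
      z1 ^ m * z2 ^ m * (c * (- 1 / z2) ^ (m - l) * (- 1 / z1) ^ (m - k))"
    if kl: "k \<le> m" "l \<le> m" for k l c
  proof -
    obtain i j where ij: "m = k + i" "m = l + j"
      using le_Suc_ex[OF kl(1)] le_Suc_ex[OF kl(2)] by blast
    have "even (k + l) \<longleftrightarrow> even (j + i)" using ij by presburger
    then have e: "(- 1) ^ k * (- 1) ^ l = (- 1 :: complex) ^ j * (- 1) ^ i"
      unfolding power_add[symmetric] by (simp only: minus_one_power_iff)
    have 1: "z1 ^ m = z1 ^ k * z1 ^ i" using ij(1) by (simp add: power_add)
    have 2: "z2 ^ m = z2 ^ l * z2 ^ j" using ij(2) by (simp add: power_add)
    have ms: "m - l = j" "m - k = i" using ij by auto
    show ?thesis
      unfolding 1 2 ms power_divide power_add e using assms(3,4) by simp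
  qed
  have r: "(\<Sum>k\<le>m. \<Sum>l\<le>m. f k l) = (\<Sum>k\<le>m. \<Sum>l\<le>m. f (m - l) (m - k))" for f :: "nat \<Rightarrow> nat \<Rightarrow> complex"
  proof -
    have *: "(\<Sum>k\<le>m. h k) = (\<Sum>k\<le>m. h (m - k))" for h :: "nat \<Rightarrow> complex"
      using sum.nat_diff_reindex[of h "Suc m"] by (simp add: lessThan_Suc_atMost)
    show ?thesis by (subst sum.swap, subst *, subst (2) *) simp
  qed
  have "poly2 (antipodal m F) z1 z2 =
      (\<Sum>k\<le>m. \<Sum>l\<le>m. coeff2 (antipodal m F) k l * z1 ^ k * z2 ^ l)"
    using degree_antipodal[of m F]
    by (intro poly2_altdef_gen) (auto simp: coeff2_antipodal coeff_eq_0)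
  also have "\<dots> = (\<Sum>k\<le>m. \<Sum>l\<le>m. z1 ^ m * z2 ^ m *
      (coeff2 F (m - l) (m - k) * (- 1 / z2) ^ (m - l) * (- 1 / z1) ^ (m - k)))"
    by (intro sum.cong refl) (simp only: coeff2_antipodal t atMost_iff simp_thms if_True)
  also have "\<dots> = z1 ^ m * z2 ^ m * poly2 F (- 1 / z2) (- 1 / z1)"
    unfolding poly2_altdef[OF assms(1,2)] sum_distrib_left by (rule r[symmetric])
  finally show ?thesis .
qed

text \<open>The cofactor has degree \<open>0\<close> in \<open>z\<^sub>1\<close> because \<open>Q\<close> already has the full degree \<open>m\<close> there, and in
  \<open>z\<^sub>2\<close> for the same reason, since a real-valued polynomial has equal degrees in both variables. It
  is real because the coefficient matrices of \<open>Q\<close> and of its transform are both Hermitian.\<close>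

lemma antipodal_dvd_imp_real_multiple:
  assumes Q: "real_valued Q" "degree Q = m" "Q \<noteq> 0" and dvd: "Q dvd antipodal m Q"
  obtains a :: real where "a \<noteq> 0" "antipodal m Q = [:[:complex_of_real a:]:] * Q"
proof -
  obtain h where h: "antipodal m Q = Q * h" using dvd by blast
  have nz: "antipodal m Q \<noteq> 0" using antipodal_eq_0_iff[OF Q(1)] Q by simp
  then have "h \<noteq> 0" using h by auto
  have "degree (Q * h) = m + degree h" using degree_mult_eq[OF Q(3) \<open>h \<noteq> 0\<close>] Q(2) by simp
  then have "degree h = 0" using degree_antipodal[of m Q] h by simp
  then obtain c where c: "h = [:c:]" by (rule degree_eq_zeroE)
  then have "c \<noteq> 0" using \<open>h \<noteq> 0\<close> by auto
  have co: "coeff (antipodal m Q) k = c * coeff Q k" for k unfolding h c by simp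
  obtain j where "coeff2 Q m j \<noteq> 0"
    using Q by (metis coeff2_def leading_coeff_0_iff poly_eqI coeff_0)
  then have j: "coeff2 Q j m \<noteq> 0" using real_valued_coeff2[OF Q(1), of m j] by simp
  then have "coeff Q j \<noteq> 0" "m \<le> degree (coeff Q j)" by (auto simp: coeff2_def le_degree)
  then have "m + degree c \<le> degree (coeff (antipodal m Q) j)"
    unfolding co using \<open>c \<noteq> 0\<close> by (simp add: degree_mult_eq)
  also have "\<dots> \<le> m"
    by (rule degree_le) (auto simp: coeff2_antipodal simp flip: coeff2_def)
  finally have "degree c = 0" by simp
  then obtain b where b: "c = [:b:]" by (rule degree_eq_zeroE)
  then have "b \<noteq> 0" using \<open>c \<noteq> 0\<close> by auto
  have cb: "coeff2 (antipodal m Q) k l = b * coeff2 Q k l" for k l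
    using co[of k] b by (simp add: coeff2_def)
  have herm: "coeff2 (antipodal m Q) l k = cnj (coeff2 (antipodal m Q) k l)" for k l
    using real_valued_coeff2[OF Q(1), of "m - k" "m - l"]
    by (auto simp: coeff2_antipodal add.commute)
  have "b * coeff2 Q m j = cnj b * coeff2 Q m j"
    using herm[of m j] real_valued_coeff2[OF Q(1), of m j] unfolding cb by simp
  then have "b = cnj b" using \<open>coeff2 Q m j \<noteq> 0\<close> by simp
  then obtain a where a: "b = complex_of_real a" by (metis Reals_cases Reals_cnj_iff)
  show thesis
  proof
    show "a \<noteq> 0" using a \<open>b \<noteq> 0\<close> by auto
    show "antipodal m Q = [:[:complex_of_real a:]:] * Q" unfolding h c b a by (simp add: mult.commute)
  qed
qed

section \<open>Support functions and the sphere\<close>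

lemma support_function_lipschitz:
  assumes "closed_convex_surface S"
  shows "\<exists>B. B-lipschitz_on UNIV (support_function S)"
proof -
  obtain C where "compact C" "S = frontier C"
    using assms by (auto simp: closed_convex_surface_def)
  then have "bounded S" by (simp add: compact_frontier compact_imp_bounded)
  then obtain B where B: "B > 0" "\<And>x. x \<in> S \<Longrightarrow> norm x \<le> B" using bounded_pos by blast
  have le: "support_function S u \<le> support_function S v + B * dist u v" for u v
  proof -
    obtain x where x: "x \<in> S" "u \<bullet> x = support_function S u"
      using support_function_tangent_plane[OF assms, of u] by blast
    have "v \<bullet> x \<le> support_function S v"
      using support_function_tangent_plane[OF assms, of v] x(1) by blast
    moreover have "(u - v) \<bullet> x \<le> norm (u - v) * norm x" by (rule norm_cauchy_schwarz)
    moreover have "norm (u - v) * norm x \<le> norm (u - v) * B"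
      using B(2)[OF x(1)] by (simp add: mult_left_mono)
    ultimately show ?thesis using x(2) by (simp add: inner_diff_left dist_norm mult.commute)
  qed
  have "B-lipschitz_on UNIV (support_function S)"
  proof (rule lipschitz_onI)
    show "dist (support_function S u) (support_function S v) \<le> B * dist u v" for u v
      using le[of u v] le[of v u] by (simp add: dist_real_def dist_commute abs_le_iff)
  qed (use B in simp)
  then show ?thesis ..
qed

text \<open>Only the south pole has no coordinate, and it is the antipode of \<open>\<xi> = 0\<close>.\<close>

lemma sphere_cases:
  assumes "u \<in> sphere 0 1"
  obtains \<xi> where "u = sph \<xi> \<or> u = - sph \<xi>"
proof -
  define a b c where "a = u $ 1" and "b = u $ 2" and "c = u $ 3"
  have "norm u = 1" using assms by simp
  then have "u \<bullet> u = 1" by (simp add: power2_norm_eq_inner[symmetric])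
  then have n: "a\<^sup>2 + b\<^sup>2 + c\<^sup>2 = 1"
    by (simp add: inner_vec_def sum_3 a_def b_def c_def power2_eq_square)
  show thesis
  proof (cases "c = - 1")
    case True
    then have "a = 0" "b = 0" using n by (auto simp: sum_power2_eq_zero_iff)
    then have "u = - sph 0"
      using True by (simp add: sph_def vec_eq_iff forall_3 vector_3 a_def b_def c_def)
    then show thesis using that by blast
  next
    case False
    then have c: "1 + c \<noteq> 0" by linarith
    define \<xi> where "\<xi> = Complex (a / (1 + c)) (b / (1 + c))"
    have "(cmod \<xi>)\<^sup>2 = (a\<^sup>2 + b\<^sup>2) / (1 + c)\<^sup>2"
      by (simp add: \<xi>_def cmod_power2 power_divide add_divide_distrib)
    also have "a\<^sup>2 + b\<^sup>2 = (1 - c) * (1 + c)" using n by (simp add: power2_eq_square algebra_simps)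
    finally have m: "(cmod \<xi>)\<^sup>2 = (1 - c) / (1 + c)" using c by (simp add: power2_eq_square)
    have s: "1 / (1 + (1 - c) / (1 + c)) = (1 + c) / 2" using c by (simp add: field_simps)
    have "sph \<xi> = u"
      unfolding sph_def m s vec_eq_iff forall_3 using c
      by (simp add: vector_3 \<xi>_def a_def b_def c_def field_simps)
    then show thesis using that by blast
  qed
qed

lemma continuous_on_sph: "continuous_on UNIV sph"
proof -
  have "1 + (cmod \<xi>)\<^sup>2 \<noteq> 0" for \<xi> by (smt (verit) zero_le_power2)
  moreover have "continuous_on UNIV (\<lambda>\<xi>. vector [2 * Re \<xi>, 2 * Im \<xi>, 1 - (cmod \<xi>)\<^sup>2] :: real ^ 3)"
  proof (rule continuous_on_vec_lambda
      [where f = "\<lambda>i \<xi>. vector [2 * Re \<xi>, 2 * Im \<xi>, 1 - (cmod \<xi>)\<^sup>2] $ i", unfolded vec_lambda_eta])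
    fix i :: 3
    show "continuous_on UNIV (\<lambda>\<xi>. (vector [2 * Re \<xi>, 2 * Im \<xi>, 1 - (cmod \<xi>)\<^sup>2] :: real ^ 3) $ i)"
      using exhaust_3[of i] by (elim disjE) (simp_all add: vector_3 continuous_intros)
  qed
  ultimately show ?thesis unfolding sph_def by (intro continuous_intros) auto
qed

section \<open>Constant width\<close>

theorem theorem5:
  fixes S :: "(real ^ 3) set"
    and P Q :: "complex poly poly"
    and n m :: nat
    and w :: real
  assumes "closed_convex_surface S"
    and "rational_support S P Q"
    and "coprime P Q"
    and "degree P = n" and "degree Q = m" and "n \<le> m"
  shows "constant_width S w \<longleftrightarrow>
    (\<exists>K::real. K \<noteq> 0 \<and>
      (\<forall>\<xi>. \<xi> \<noteq> 0 \<longrightarrow>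
        poly2 Q (- 1 / cnj \<xi>) (- 1 / \<xi>) =
          1 / (complex_of_real K * \<xi> ^ m * cnj \<xi> ^ m) * poly2 Q \<xi> (cnj \<xi>)) \<and>
      (\<forall>k\<le>m. \<forall>l\<le>m.
        coeff2 P k l + (- 1) ^ (k + l) * complex_of_real K * coeff2 P (m - l) (m - k) =
          complex_of_real w * coeff2 Q k l))"
proof -
  define h where "h = support_function S"
  define T where "T \<xi> = - 1 / cnj \<xi>" for \<xi>
  define P' Q' where "P' = antipodal m P" and "Q' = antipodal m Q"
  have rP: "real_valued P" and rQ: "real_valued Q" and Q0: "Q \<noteq> 0"
    and r: "\<And>\<xi>. poly2 Q \<xi> (cnj \<xi>) \<noteq> 0 \<Longrightarrow>
      complex_of_real (h (sph \<xi>)) = poly2 P \<xi> (cnj \<xi>) / poly2 Q \<xi> (cnj \<xi>)"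
    using assms(2) by (auto simp: rational_support_def h_def)
  have dP: "degree P \<le> m" and dQ: "degree Q \<le> m" using assms by auto
  have cT: "cnj (T \<xi>) = - 1 / \<xi>" for \<xi> by (simp add: T_def)
  have P': "poly2 P' \<xi> (cnj \<xi>) = \<xi> ^ m * cnj \<xi> ^ m * poly2 P (T \<xi>) (cnj (T \<xi>))"
    and Q': "poly2 Q' \<xi> (cnj \<xi>) = \<xi> ^ m * cnj \<xi> ^ m * poly2 Q (T \<xi>) (cnj (T \<xi>))" if "\<xi> \<noteq> 0" for \<xi>
    using poly2_antipodal[OF rP dP, of \<xi> "cnj \<xi>"] poly2_antipodal[OF rQ dQ, of \<xi> "cnj \<xi>"] that
    unfolding P'_def Q'_def cT by (simp_all add: T_def)
  have sT: "sph (T \<xi>) = - sph \<xi>" if "\<xi> \<noteq> 0" for \<xi>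
    using sph_antipodal[OF that] by (simp add: T_def)
  \<comment> \<open>No index above \<open>m\<close> contributes to the polynomial identity, by the bounds on the degrees.\<close>
  have cond2: "(\<forall>k\<le>m. \<forall>l\<le>m.
        coeff2 P k l + (- 1) ^ (k + l) * complex_of_real K * coeff2 P (m - l) (m - k) =
          complex_of_real w * coeff2 Q k l) \<longleftrightarrow>
      P + [:[:complex_of_real K:]:] * P' = [:[:complex_of_real w:]:] * Q" (is "?L \<longleftrightarrow> ?R") for K
  proof -
    have "?R \<longleftrightarrow> (\<forall>k l. coeff2 P k l + complex_of_real K * coeff2 P' k l =
        complex_of_real w * coeff2 Q k l)"
      by (simp add: poly_eq_iff coeff2_def)
    also have "\<dots> \<longleftrightarrow> ?L"
      using coeff2_eq_0_of_degree[OF rP dP] coeff2_eq_0_of_degree[OF rQ dQ]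
      unfolding P'_def coeff2_antipodal
      by (smt (verit, best) add_0 mult.assoc mult.commute mult_zero_right not_le)
    finally show ?thesis by blast
  qed
  show ?thesis unfolding cond2
  proof (rule iffI, goal_cases)
    case 1
    define F where "F = P * Q' + P' * Q - [:[:complex_of_real w:]:] * Q * Q'"
    \<comment> \<open>The extra factors, of which \<open>[:0, 1:]\<close> is \<open>z\<^sub>1\<close>, vanish where constant width gives no information
      on \<open>F\<close>; they are nonzero polynomials, so they cancel afterwards.\<close>
    have "poly2 ([:0, 1:] * Q * Q' * F) \<xi> (cnj \<xi>) = 0" for \<xi>
    proof (cases "\<xi> = 0 \<or> poly2 Q \<xi> (cnj \<xi>) = 0 \<or> poly2 Q' \<xi> (cnj \<xi>) = 0")
      case False
      then have \<xi>: "\<xi> \<noteq> 0" and q: "poly2 Q \<xi> (cnj \<xi>) \<noteq> 0" and q': "poly2 Q' \<xi> (cnj \<xi>) \<noteq> 0" by auto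
      have qT: "poly2 Q (T \<xi>) (cnj (T \<xi>)) \<noteq> 0" using q' Q'[OF \<xi>] by auto
      have "h (sph \<xi>) + h (sph (T \<xi>)) = w"
        using 1 norm_sph[of \<xi>] by (simp add: constant_width_def h_def sT[OF \<xi>])
      then have "complex_of_real (h (sph \<xi>)) + complex_of_real (h (sph (T \<xi>))) = complex_of_real w"
        by (metis of_real_add)
      moreover have "complex_of_real (h (sph (T \<xi>))) = poly2 P' \<xi> (cnj \<xi>) / poly2 Q' \<xi> (cnj \<xi>)"
        unfolding r[OF qT] P'[OF \<xi>] Q'[OF \<xi>] using \<xi> by simp
      ultimately have "poly2 P \<xi> (cnj \<xi>) / poly2 Q \<xi> (cnj \<xi>) +
          poly2 P' \<xi> (cnj \<xi>) / poly2 Q' \<xi> (cnj \<xi>) = complex_of_real w"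
        using r[OF q] by simp
      then have "poly2 P \<xi> (cnj \<xi>) * poly2 Q' \<xi> (cnj \<xi>) + poly2 P' \<xi> (cnj \<xi>) * poly2 Q \<xi> (cnj \<xi>) =
          complex_of_real w * (poly2 Q \<xi> (cnj \<xi>) * poly2 Q' \<xi> (cnj \<xi>))"
        unfolding add_frac_eq[OF q q'] using q q' by (simp only: divide_eq_eq mult_eq_0_iff) simp
      then have "poly2 F \<xi> (cnj \<xi>) = 0" unfolding F_def by (simp add: mult.assoc)
      then show ?thesis by simp
    qed auto
    then have "[:0, 1:] * Q * Q' * F = 0" by (rule poly2_conj_eq_0_imp_eq_0)
    moreover have "Q' \<noteq> 0" unfolding Q'_def using antipodal_eq_0_iff[OF rQ dQ] Q0 by simp
    ultimately have F: "F = 0" using Q0 by simp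
    then have "P * Q' = Q * ([:[:complex_of_real w:]:] * Q' - P')"
      unfolding F_def by (simp add: algebra_simps)
    then have "Q dvd P * Q'" by (rule dvdI)
    \<comment> \<open>The ring \<open>\<complex>[z\<^sub>1, z\<^sub>2]\<close> is factorial, so a coprime factor can be cancelled.\<close>
    then have "Q dvd Q'"
      using assms(3) coprime_commute coprime_dvd_mult_right_iff by blast
    then obtain a :: real where a: "a \<noteq> 0" "Q' = [:[:complex_of_real a:]:] * Q"
      using antipodal_dvd_imp_real_multiple[OF rQ assms(5) Q0] unfolding Q'_def by blast
    define A A' W where "A = [:[:complex_of_real a:]:]" and "A' = [:[:complex_of_real (1 / a):]:]"
      and "W = [:[:complex_of_real w:]:]"
    have inv: "A' * A = 1" using a(1) by (simp add: A_def A'_def one_pCons flip: of_real_mult)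
    have "Q * (A * P + P' - A * (W * Q)) = F"
      unfolding F_def a(2) A_def[symmetric] W_def[symmetric] by (simp only: algebra_simps)
    then have "A * P + P' = A * (W * Q)" using F Q0 by simp
    then have "A' * (A * P + P') = A' * (A * (W * Q))" by simp
    then have 2: "P + A' * P' = W * Q"
      unfolding distrib_left mult.assoc[symmetric] inv by simp
    have "poly2 Q (- 1 / cnj \<xi>) (- 1 / \<xi>) =
        1 / (complex_of_real (1 / a) * \<xi> ^ m * cnj \<xi> ^ m) * poly2 Q \<xi> (cnj \<xi>)" if "\<xi> \<noteq> 0" for \<xi>
      using Q'[OF that] that a unfolding cT by (simp add: T_def field_simps)
    then show ?case using 2 a(1) unfolding A'_def W_def by (intro exI[of _ "1 / a"]) simp
  next
    case 2
    then obtain K :: real where K: "K \<noteq> 0"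
      and c1: "\<And>\<xi>. \<xi> \<noteq> 0 \<Longrightarrow> poly2 Q (T \<xi>) (cnj (T \<xi>)) =
          1 / (complex_of_real K * \<xi> ^ m * cnj \<xi> ^ m) * poly2 Q \<xi> (cnj \<xi>)"
      and c2: "P + [:[:complex_of_real K:]:] * P' = [:[:complex_of_real w:]:] * Q"
      unfolding cT by (auto simp: T_def)
    \<comment> \<open>The factor \<open>z\<^sub>1\<close> excludes \<open>\<xi> = 0\<close>, whose antipode has no coordinate.\<close>
    have generic: "h (sph \<xi>) + h (- sph \<xi>) = w" if "poly2 ([:0, 1:] * Q) \<xi> (cnj \<xi>) \<noteq> 0" for \<xi>
    proof -
      have \<xi>: "\<xi> \<noteq> 0" and q: "poly2 Q \<xi> (cnj \<xi>) \<noteq> 0" using that by auto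
      have qT: "poly2 Q (T \<xi>) (cnj (T \<xi>)) \<noteq> 0" using c1[OF \<xi>] \<xi> q K by simp
      have "complex_of_real (h (sph (T \<xi>))) =
          complex_of_real K * poly2 P' \<xi> (cnj \<xi>) / poly2 Q \<xi> (cnj \<xi>)"
        unfolding r[OF qT] P'[OF \<xi>] unfolding c1[OF \<xi>] using \<xi> K q by (simp add: field_simps)
      moreover have "poly2 P \<xi> (cnj \<xi>) + complex_of_real K * poly2 P' \<xi> (cnj \<xi>) =
          complex_of_real w * poly2 Q \<xi> (cnj \<xi>)"
        using arg_cong[OF c2, of "\<lambda>F. poly2 F \<xi> (cnj \<xi>)"] by simp
      ultimately have "complex_of_real (h (sph \<xi>)) + complex_of_real (h (sph (T \<xi>))) = complex_of_real w"
        unfolding r[OF q] using q by (simp add: field_simps)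
      then have "h (sph \<xi>) + h (sph (T \<xi>)) = w" by (metis of_real_add of_real_eq_iff)
      then show ?thesis unfolding sT[OF \<xi>] .
    qed
    have h: "continuous_on UNIV h"
      using support_function_lipschitz[OF assms(1)] lipschitz_on_continuous_on
      unfolding h_def by blast
    have cont: "continuous_on UNIV (\<lambda>\<xi>. h (sph \<xi>) + h (- sph \<xi>))"
      by (rule continuous_on_add; rule continuous_on_compose2[OF h])
        (simp_all add: continuous_on_sph continuous_on_minus)
    have "[:0, 1:] * Q \<noteq> 0" using Q0 by simp
    then have "h (sph \<xi>) + h (- sph \<xi>) = w" for \<xi>
      by (rule continuous_eq_const_off_zero_set[OF _ cont]) (rule generic)
    then have "h u + h (- u) = w" if "u \<in> sphere 0 1" for u
      using sphere_cases[OF that] by (metis add.commute minus_minus)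
    then show ?case by (simp add: constant_width_def h_def)
  qed
qed

end
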